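(* Let $S$ be a $d$-variate spectral random vector with Lebesgue density $f_S$ defined on $\{s\in\mathbb R^d:\max(s)=0\}$ (that is, the law of $S$ is absolutely continuous with density $f_S$ with respect to $(d-1)$-dimensional Lebesgue measure on that set). Let $Z=S+E$ be the associated generalized Pareto random vector, where $E$ is a unit exponential random variable independent of $S$. Then $Z$ has a density with respect to $d$-dimensional Lebesgue measure, given by $$h(z)=\mathbf 1(z\not\le 0)\,f_S\bigl(z-\max(z)\bigr)\,e^{-\max(z)},\qquad z\in\mathbb R^d.$$
   Context: Conventions: $\max(x)=\max(x_1,\dots,x_d)$; scalars are added to/subtracted from every component of a vector; $z\not\le 0$ means $z_j>0$ for at least one $j$; $\mathbf 1(\cdot)$ is an indicator. A random vector $S$ with values in $[-\infty,0]^d$ is called a spectral random vector if $\Pr[\max(S_1,\dots,S_d)=0]=1$ and $\Pr[S_j>-\infty]>0$ for all $j=1,\dots,d$. The set $\{s\in\mathbb R^d:\max(s)=0\}$ is the union of the flat pieces $\mathcal S_j=\{s\in\mathbb R^d:s_j=\max(s)=0\}$, $j=1,\dots,d$, which overlap only in $(d-1)$-dimensional null sets; the $(d-1)$-dimensional Lebesgue measure on it is, on each $\mathcal S_j$, the Lebesgue measure in the coordinates $(s_i)_{i\ne j}$. Thus $f_S$ being the density of $S$ means $\Pr[S\in B]=\sum_{j=1}^d\int_{\mathcal S_j}\mathbf 1(s\in B)f_S(s)\,ds_{-j}$ for Borel sets $B$, where $ds_{-j}=\prod_{i\neq j}ds_i$. *)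

theory Defs
  imports "HOL-Probability.Probability"
begin

definition vmax :: "'a::linorder ^ 'n \<Rightarrow> 'a" where
  "vmax x = Max (range (\<lambda>j. x $ j))"

definition ereal_vec :: "real ^ 'n \<Rightarrow> ereal ^ 'n" where
  "ereal_vec s = (\<chi> j. ereal (s $ j))"

text \<open>Junk value: infinite components are sent to 0.\<close>

definition real_vec :: "ereal ^ 'n \<Rightarrow> real ^ 'n" where
  "real_vec z = (\<chi> j. real_of_ereal (z $ j))"

definition spectral_random_vector :: "'w measure \<Rightarrow> ('w \<Rightarrow> ereal ^ 'n) \<Rightarrow> bool" where
  "spectral_random_vector M S \<longleftrightarrow>
     S \<in> borel_measurable M \<and>
     (\<forall>\<omega>\<in>space M. \<forall>j. S \<omega> $ j \<le> 0) \<and>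
     measure M {\<omega> \<in> space M. vmax (S \<omega>) = 0} = 1 \<and>
     (\<forall>j. measure M {\<omega> \<in> space M. S \<omega> $ j > -\<infinity>} > 0)"

text \<open>
  As the library's \<open>indep_var\<close>, which however requires both variables to take values in the same type.
\<close>

definition indep_rv ::
    "'w measure \<Rightarrow> 'a measure \<Rightarrow> ('w \<Rightarrow> 'a) \<Rightarrow> 'b measure \<Rightarrow> ('w \<Rightarrow> 'b) \<Rightarrow> bool" where
  "indep_rv M K X L Y \<longleftrightarrow>
     X \<in> measurable M K \<and> Y \<in> measurable M L \<and>
     prob_space.indep_set M
       (sigma_sets (space M) {X -` A \<inter> space M | A. A \<in> sets K})
       (sigma_sets (space M) {Y -` B \<inter> space M | B. B \<in> sets L})"

definition max_zero_set :: "(real ^ 'n) set" where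
  "max_zero_set = {s. vmax s = 0}"

definition face :: "'n \<Rightarrow> (real ^ 'n) set" where
  "face j = {s. s $ j = vmax s \<and> vmax s = 0}"

definition insert_zero :: "'n \<Rightarrow> ('n \<Rightarrow> real) \<Rightarrow> real ^ 'n" where
  "insert_zero j x = (\<chi> i. if i = j then 0 else x i)"

text \<open>
  The integral over the face \<open>j\<close> is taken in the coordinates \<open>s i\<close> with \<open>i \<noteq> j\<close>, that is, against
  the product Lebesgue measure on \<open>UNIV - {j}\<close> (a unit point mass when the dimension is one).
  Only the values of \<open>f\<close> on the set of points with maximum zero matter.
  The sets \<open>B\<close> range over the Borel sets of the extended space, so that the law of \<open>S\<close> as a whole,
  including the absence of mass at points with infinite components, is described by \<open>f\<close>.
\<close>

definition has_face_density ::
    "'w measure \<Rightarrow> ('w \<Rightarrow> ereal ^ 'n) \<Rightarrow> (real ^ 'n \<Rightarrow> real) \<Rightarrow> bool" where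
  "has_face_density M S f \<longleftrightarrow>
     f \<in> borel_measurable (restrict_space borel max_zero_set) \<and>
     (\<forall>s\<in>max_zero_set. 0 \<le> f s) \<and>
     (\<forall>B\<in>sets borel.
        emeasure M (S -` B \<inter> space M) =
        (\<Sum>j\<in>UNIV. \<integral>\<^sup>+ x. indicator (face j) (insert_zero j x) *
                         indicator B (ereal_vec (insert_zero j x)) *
                         ennreal (f (insert_zero j x))
                   \<partial>(\<Pi>\<^sub>M i\<in>UNIV - {j}. lborel)))"

text \<open>
  A random vector in the extended space has a density on the real space if it is almost surely
  finite and its finite version has that density.
\<close>

definition has_lebesgue_density ::
    "'w measure \<Rightarrow> ('w \<Rightarrow> ereal ^ 'n) \<Rightarrow> (real ^ 'n \<Rightarrow> real) \<Rightarrow> bool" where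
  "has_lebesgue_density M Z h \<longleftrightarrow>
     (AE \<omega> in M. Z \<omega> \<in> range ereal_vec) \<and>
     (\<forall>z. 0 \<le> h z) \<and>
     distributed M lborel (\<lambda>\<omega>. real_vec (Z \<omega>)) (\<lambda>z. ennreal (h z))"

end

theory Submission
  imports Defs
begin

text \<open>
  Each point with positive maximum is uniquely \<open>z = s + e\<close> with \<open>max s = 0\<close> and \<open>e = max z\<close>. Over the
  face \<open>j\<close>, the map from the free coordinates of \<open>s\<close> and \<open>e\<close> to \<open>z\<close> is a shear, hence preserves
  Lebesgue measure, and it covers the points whose maximum is attained at \<open>j\<close>. Pushing the product
  of the law of \<open>S\<close> and the exponential law forward and adding up the faces, which overlap only
  where two coordinates of \<open>z\<close> agree, gives the density. Infinite components of \<open>S\<close> carry no mass.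
\<close>

section \<open>Componentwise maximum\<close>

lemma vmax_eqI:
  fixes x :: "'a::linorder ^ 'n"
  assumes "x $ j = m" "\<And>i. x $ i \<le> m"
  shows "vmax x = m"
  unfolding vmax_def using assms by (intro Max_eqI) auto

lemma component_le_vmax: "x $ j \<le> vmax (x :: 'a::linorder ^ 'n)"
  by (simp add: vmax_def)

lemma vmax_attained:
  obtains j where "x $ j = vmax (x :: 'a::linorder ^ 'n)"
proof -
  have "vmax x \<in> range (\<lambda>j. x $ j)"
    unfolding vmax_def by (intro Max_in) auto
  then show thesis
    using that by auto
qed

lemma vmax_add_vec: "vmax (x + vec c) = vmax x + (c :: real)"
proof -
  obtain j where "x $ j = vmax x"
    by (rule vmax_attained)
  then show ?thesis
    by (intro vmax_eqI[of _ j]) (auto simp: component_le_vmax)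
qed

lemma vmax_minus_vec_vmax: "vmax (z - vec (vmax z)) = (0 :: real)"
  using vmax_add_vec[of "z - vec (vmax z)" "vmax z"] by simp

lemma not_le_zero_iff_vmax_pos: "\<not> z \<le> 0 \<longleftrightarrow> 0 < vmax (z :: real ^ 'n)"
  by (metis component_le_vmax dual_order.trans less_eq_vec_def linorder_not_less
      vmax_attained zero_index)

section \<open>Borel measurability of vector operations, and the finite points of the extended
  space\<close>

lemma borel_measurable_vec_nth [measurable]:
  "(\<lambda>x :: 'a::topological_space ^ 'n. x $ i) \<in> borel_measurable borel"
  by (intro borel_measurable_continuous_onI continuous_intros)

lemma borel_measurable_vec_lambda:
  assumes "\<And>i. (\<lambda>x. f x i) \<in> borel_measurable N"
  shows "(\<lambda>x. (\<chi> i. f x i) :: real ^ 'n) \<in> borel_measurable N"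
  using assms by (subst borel_measurable_euclidean_space) (auto simp: Basis_vec_def inner_axis)

lemma borel_measurable_vmax [measurable]: "(vmax :: real ^ 'n \<Rightarrow> real) \<in> borel_measurable borel"
  unfolding vmax_def by (intro borel_measurable_Max) auto

lemma borel_measurable_vec [measurable]: "(vec :: real \<Rightarrow> real ^ 'n) \<in> borel_measurable borel"
  unfolding vec_def by (intro borel_measurable_vec_lambda) auto

lemma borel_measurable_ereal_vec [measurable]:
  "(ereal_vec :: real ^ 'n \<Rightarrow> ereal ^ 'n) \<in> borel_measurable borel"
  unfolding ereal_vec_def
  by (intro borel_measurable_continuous_onI continuous_intros continuous_on_vec_lambda)

lemma borel_measurable_real_vec_add_vec [measurable]:
  "(\<lambda>(s, e). real_vec (s + vec (ereal e) :: ereal ^ 'n)) \<in> borel_measurable (borel \<Otimes>\<^sub>M borel)"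
  unfolding real_vec_def case_prod_beta
  by (intro borel_measurable_vec_lambda) (simp, measurable)

lemma real_vec_ereal_vec_add: "real_vec (ereal_vec t + vec (ereal e)) = t + vec e"
  by (simp add: real_vec_def ereal_vec_def vec_eq_iff)

text \<open>Stating finiteness component by component makes the set of finite points visibly Borel,
  which an image need not be.\<close>

lemma range_ereal_vec: "range ereal_vec = {z :: ereal ^ 'n. \<forall>i. \<bar>z $ i\<bar> \<noteq> \<infinity>}"
proof -
  have "z = ereal_vec (real_vec z)" if "\<forall>i. \<bar>z $ i\<bar> \<noteq> \<infinity>" for z :: "ereal ^ 'n"
    using that by (simp add: ereal_vec_def real_vec_def vec_eq_iff ereal_real')
  then show ?thesis
    by (auto simp: ereal_vec_def)
qed

lemma range_ereal_vec_borel [measurable]: "range (ereal_vec :: real ^ 'n \<Rightarrow> _) \<in> sets borel"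
  unfolding range_ereal_vec by measurable

section \<open>Lebesgue measure in coordinates\<close>

interpretation lborel: product_sigma_finite "\<lambda>i. lborel :: real measure"
  by standard

lemma measurable_insert_zero [measurable]:
  "insert_zero j \<in> measurable (\<Pi>\<^sub>M i\<in>UNIV - {j}. lborel) (borel :: (real ^ 'n) measure)"
  unfolding insert_zero_def
proof (intro borel_measurable_vec_lambda)
  fix i
  show "(\<lambda>x. if i = j then 0 else x i) \<in> borel_measurable (\<Pi>\<^sub>M i\<in>UNIV - {j}. (lborel :: real measure))"
  proof (cases "i = j")
    case False
    then have "(\<lambda>x. x i) \<in> measurable (\<Pi>\<^sub>M i\<in>UNIV - {j}. (lborel :: real measure)) lborel"
      by (intro measurable_component_singleton) auto
    with False show ?thesis by simp
  qed simp
qed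

lemma measurable_vec_lambda_PiM:
  "vec_lambda \<in> measurable (\<Pi>\<^sub>M i\<in>UNIV. lborel) (borel :: (real ^ 'n) measure)"
proof (rule borel_measurable_vec_lambda[of "\<lambda>x. x"])
  fix i :: 'n
  have "(\<lambda>x. x i) \<in> measurable (\<Pi>\<^sub>M i\<in>UNIV. (lborel :: real measure)) lborel"
    by (intro measurable_component_singleton) auto
  then show "(\<lambda>x. x i) \<in> borel_measurable (\<Pi>\<^sub>M i\<in>UNIV. (lborel :: real measure))"
    by simp
qed

text \<open>Lebesgue measure is determined by the volumes of boxes, and the preimage of a box under
  \<open>vec_lambda\<close> is a product of intervals. This makes Fubini in single coordinates
  available on \<open>real ^ 'n\<close>.\<close>

lemma lborel_vec_eq_distr_PiM:
  "(lborel :: (real ^ 'n) measure) = distr (\<Pi>\<^sub>M i\<in>UNIV. lborel) borel vec_lambda"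
proof (rule lborel_eqI)
  fix l u :: "real ^ 'n"
  assume le: "\<And>b. b \<in> Basis \<Longrightarrow> l \<bullet> b \<le> u \<bullet> b"
  have le': "l $ i \<le> u $ i" for i
    using le[of "axis i 1"] by (simp add: inner_axis axis_in_Basis_iff)
  have "vec_lambda -` box l u \<inter> space (\<Pi>\<^sub>M i\<in>UNIV. (lborel :: real measure)) =
      (\<Pi>\<^sub>E i\<in>UNIV. {l $ i<..<u $ i})"
    by (auto simp: space_PiM mem_box_cart PiE_iff)
  then have "emeasure (distr (\<Pi>\<^sub>M i\<in>UNIV. lborel) borel vec_lambda) (box l u) =
      (\<Prod>i\<in>UNIV. emeasure lborel {l $ i<..<u $ i})"
    by (simp add: emeasure_distr measurable_vec_lambda_PiM lborel.emeasure_PiM)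
  also have "\<dots> = ennreal (\<Prod>i\<in>UNIV. u $ i - l $ i)"
    using le' by (simp add: prod_ennreal)
  \<comment> \<open>The basis vectors are the \<open>axis i 1\<close>; since \<open>axis\<close> is
    injective in the index, \<open>SOME\<close> recovers it.\<close>
  also have "(\<Prod>i\<in>UNIV. u $ i - l $ i) = (\<Prod>b\<in>Basis. (u - l) \<bullet> b)"
    by (rule prod.reindex_bij_witness[of _ "\<lambda>b. SOME i. b = axis i 1" "\<lambda>i. axis i 1"])
      (auto simp: Basis_vec_def axis_eq_axis inner_axis)
  finally show "emeasure (distr (\<Pi>\<^sub>M i\<in>UNIV. lborel) borel vec_lambda) (box l u) =
      (\<Prod>b\<in>Basis. (u - l) \<bullet> b)" .
qed simp

text \<open>A product measure is determined by its rectangles, and each side of a rectangle keeps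
  its length under translation. The restricted lambda keeps the shifted function in the extensional
  space underlying the product.\<close>

lemma distr_PiM_lborel_translate:
  assumes "finite I"
  shows "distr (\<Pi>\<^sub>M i\<in>I. lborel) (\<Pi>\<^sub>M i\<in>I. lborel) (\<lambda>x. \<lambda>i\<in>I. x i + c) =
    (\<Pi>\<^sub>M i\<in>I. (lborel :: real measure))"
proof (rule lborel.PiM_eqI)
  fix A :: "'a \<Rightarrow> real set"
  assume A: "\<And>i. i \<in> I \<Longrightarrow> A i \<in> sets lborel"
  have meas: "(\<lambda>x. \<lambda>i\<in>I. x i + c) \<in> measurable (\<Pi>\<^sub>M i\<in>I. lborel) (\<Pi>\<^sub>M i\<in>I. (lborel :: real measure))"
    by measurable
  have shift: "(\<lambda>t. t + c) -` A i \<in> sets lborel"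
      "emeasure lborel ((\<lambda>t. t + c) -` A i) = emeasure lborel (A i)" if "i \<in> I" for i
  proof -
    have A': "A i \<in> sets borel" using A[OF that] by simp
    then have "(\<lambda>t. t + c) -` A i \<inter> space borel \<in> sets borel"
      by (rule measurable_sets[rotated]) measurable
    then show "(\<lambda>t. t + c) -` A i \<in> sets lborel" by simp
    have "emeasure lborel (A i) = emeasure (distr lborel borel ((+) c)) (A i)"
      by (subst lborel_distr_plus) simp
    also have "\<dots> = emeasure lborel ((\<lambda>t. t + c) -` A i)"
      using A' by (simp add: emeasure_distr vimage_def add.commute)
    finally show "emeasure lborel ((\<lambda>t. t + c) -` A i) = emeasure lborel (A i)" by simp
  qed
  have "(\<lambda>x. \<lambda>i\<in>I. x i + c) -` Pi\<^sub>E I A \<inter> space (\<Pi>\<^sub>M i\<in>I. (lborel :: real measure)) =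
      (\<Pi>\<^sub>E i\<in>I. (\<lambda>t. t + c) -` A i)"
    by (auto simp: space_PiM PiE_iff)
  moreover have "Pi\<^sub>E I A \<in> sets (\<Pi>\<^sub>M i\<in>I. (lborel :: real measure))"
    using A assms by (intro sets_PiM_I_finite) auto
  ultimately show "emeasure (distr (\<Pi>\<^sub>M i\<in>I. lborel) (\<Pi>\<^sub>M i\<in>I. lborel) (\<lambda>x. \<lambda>i\<in>I. x i + c)) (Pi\<^sub>E I A) =
      (\<Prod>i\<in>I. emeasure lborel (A i))"
    using shift assms by (simp add: emeasure_distr[OF meas] lborel.emeasure_PiM)
qed (simp_all add: assms)

text \<open>The substitution \<open>z $ j = e\<close>, \<open>z $ i = x i + e\<close> has Jacobian one.\<close>

lemma nn_integral_lborel_insert_zero: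
  fixes g :: "real ^ 'n \<Rightarrow> ennreal"
  assumes [measurable]: "g \<in> borel_measurable borel"
  shows "(\<integral>\<^sup>+ z. g z \<partial>lborel) =
    (\<integral>\<^sup>+ e. (\<integral>\<^sup>+ x. g (insert_zero j x + vec e) \<partial>(\<Pi>\<^sub>M i\<in>UNIV - {j}. lborel)) \<partial>lborel)"
proof -
  let ?P = "\<Pi>\<^sub>M i\<in>UNIV - {j}. (lborel :: real measure)"
  let ?Q = "\<Pi>\<^sub>M i\<in>insert j (UNIV - {j}). (lborel :: real measure)"
  \<comment> \<open>Writing the index set as an insertion allows Fubini to split off coordinate
    \<open>j\<close>, whose value becomes \<open>e\<close>.\<close>
  have UN: "insert j (UNIV - {j}) = (UNIV :: 'n set)" by auto
  have meas: "(\<lambda>x. g (vec_lambda x)) \<in> borel_measurable ?Q"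
    unfolding UN by (rule measurable_compose[OF measurable_vec_lambda_PiM]) measurable
  have "(\<integral>\<^sup>+ z. g z \<partial>lborel) = (\<integral>\<^sup>+ x. g (vec_lambda x) \<partial>?Q)"
    unfolding UN
    by (subst lborel_vec_eq_distr_PiM, subst nn_integral_distr) (simp_all add: measurable_vec_lambda_PiM)
  also have "\<dots> = (\<integral>\<^sup>+ e. (\<integral>\<^sup>+ x. g (vec_lambda (x(j := e))) \<partial>?P) \<partial>lborel)"
    by (rule lborel.product_nn_integral_insert_rev[OF _ _ meas]) auto
  also have "\<dots> = (\<integral>\<^sup>+ e. (\<integral>\<^sup>+ x. g (insert_zero j x + vec e) \<partial>?P) \<partial>lborel)"
  proof (rule nn_integral_cong)
    fix e :: real
    have slice: "(\<lambda>x. g (vec_lambda (x(j := e)))) \<in> borel_measurable ?P"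
    proof (rule measurable_compose[OF _ meas])
      show "(\<lambda>x. x(j := e)) \<in> measurable ?P ?Q" by measurable
    qed
    \<comment> \<open>For fixed \<open>e\<close>, shifting the remaining coordinates by
      \<open>e\<close> turns the slice into \<open>insert_zero j x + vec e\<close>; the shift
      preserves the inner measure.\<close>
    have eq: "vec_lambda ((\<lambda>i\<in>UNIV - {j}. x i + e)(j := e)) = insert_zero j x + vec e" for x
      by (simp add: vec_eq_iff insert_zero_def)
    have "(\<integral>\<^sup>+ x. g (vec_lambda (x(j := e))) \<partial>?P) =
        (\<integral>\<^sup>+ x. g (vec_lambda (x(j := e))) \<partial>distr ?P ?P (\<lambda>x. \<lambda>i\<in>UNIV - {j}. x i + e))"
      by (subst distr_PiM_lborel_translate) simp_all
    also have "\<dots> = (\<integral>\<^sup>+ x. g (insert_zero j x + vec e) \<partial>?P)"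
      using slice by (subst nn_integral_distr, measurable) (simp_all only: eq measurable_distr_eq1)
    finally show "(\<integral>\<^sup>+ x. g (vec_lambda (x(j := e))) \<partial>?P) =
        (\<integral>\<^sup>+ x. g (insert_zero j x + vec e) \<partial>?P)" .
  qed
  finally show ?thesis .
qed

section \<open>Lebesgue null sets: ties between coordinates and vanishing coordinates\<close>

lemma AE_lborel_inner_neq_zero:
  fixes a :: "'a::euclidean_space"
  assumes "a \<noteq> 0"
  shows "AE z in lborel. a \<bullet> z \<noteq> 0"
proof -
  have "{z. a \<bullet> z = 0} \<in> null_sets lebesgue"
    using negligible_hyperplane[of a 0] assms by (simp add: negligible_iff_null_sets)
  \<comment> \<open>Negligibility concerns the completed measure; the hyperplane is closed, hence
    Borel, so nullity descends to \<open>lborel\<close>.\<close>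
  then have "{z. a \<bullet> z = 0} \<in> null_sets lborel"
    by (subst (asm) null_sets_completion_iff) (auto intro!: borel_closed closed_hyperplane)
  then show ?thesis
    by (rule AE_I') auto
qed

text \<open>Ties lie in finitely many hyperplanes with normals \<open>axis i 1 - axis j 1\<close>.
  Off them the maximum is attained only once, so the face contributions do not overlap.\<close>

lemma AE_lborel_nth_distinct:
  "AE z in lborel. \<forall>i j. i \<noteq> j \<longrightarrow> z $ i \<noteq> (z :: real ^ 'n) $ j"
proof -
  have "AE z in lborel. i \<noteq> j \<longrightarrow> z $ i \<noteq> (z :: real ^ 'n) $ j" for i j
  proof (cases "i = j")
    case False
    then have "axis i 1 - axis j 1 \<noteq> (0 :: real ^ 'n)"
      by (simp add: axis_eq_axis)
    from AE_lborel_inner_neq_zero[OF this] show ?thesis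
      by (simp add: inner_diff_left inner_axis')
  qed simp
  then show ?thesis
    by (simp add: AE_all_countable)
qed

text \<open>This serves to discard the points with maximum exactly 0, where the exponential density
  is 1 but the indicator in the target density is 0.\<close>

lemma AE_lborel_nth_nonzero: "AE z in lborel. \<forall>i. (z :: real ^ 'n) $ i \<noteq> 0"
proof -
  have "AE z in lborel. (z :: real ^ 'n) $ i \<noteq> 0" for i
    using AE_lborel_inner_neq_zero[of "axis i 1 :: real ^ 'n"] by (simp add: inner_axis' axis_eq_0_iff)
  then show ?thesis
    by (simp add: AE_all_countable)
qed

section \<open>Laws of random variables\<close>

text \<open>Independence is the product formula on rectangles, and rectangles determine a product of
  sigma-finite measures. The two variables may take values in different types, as \<open>S\<close>
  and \<open>E\<close> do.\<close>

lemma distr_pair_indep_rv: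
  assumes M: "prob_space M" and indep: "indep_rv M K X L Y"
  shows "distr M (K \<Otimes>\<^sub>M L) (\<lambda>\<omega>. (X \<omega>, Y \<omega>)) = distr M K X \<Otimes>\<^sub>M distr M L Y"
proof -
  interpret prob_space M by fact
  have X [measurable]: "X \<in> measurable M K" and Y [measurable]: "Y \<in> measurable M L"
    using indep by (auto simp: indep_rv_def)
  have prod: "prob ((X -` A \<inter> space M) \<inter> (Y -` B \<inter> space M)) =
      prob (X -` A \<inter> space M) * prob (Y -` B \<inter> space M)"
    if "A \<in> sets K" "B \<in> sets L" for A B
    using indep that unfolding indep_rv_def by (intro indep_setD) auto
  interpret X: prob_space "distr M K X" by (rule prob_space_distr) fact
  interpret Y: prob_space "distr M L Y" by (rule prob_space_distr) fact
  have "distr M K X \<Otimes>\<^sub>M distr M L Y = distr M (K \<Otimes>\<^sub>M L) (\<lambda>\<omega>. (X \<omega>, Y \<omega>))"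
  proof (rule pair_measure_eqI)
    fix A B assume "A \<in> sets (distr M K X)" "B \<in> sets (distr M L Y)"
    then have AB: "A \<in> sets K" "B \<in> sets L" by auto
    have "(\<lambda>\<omega>. (X \<omega>, Y \<omega>)) -` (A \<times> B) \<inter> space M = (X -` A \<inter> space M) \<inter> (Y -` B \<inter> space M)"
      by auto
    with AB prod[OF AB] show "emeasure (distr M K X) A * emeasure (distr M L Y) B =
        emeasure (distr M (K \<Otimes>\<^sub>M L) (\<lambda>\<omega>. (X \<omega>, Y \<omega>))) (A \<times> B)"
      by (simp add: emeasure_distr emeasure_eq_measure ennreal_mult')
  qed (auto intro: X.sigma_finite_measure_axioms Y.sigma_finite_measure_axioms cong: sets_pair_measure_cong)
  then show ?thesis by simp
qed

text \<open>The face density is specified on sets only; this carries such an identity over to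
  integrals by induction from indicators to monotone limits. There the supremum passes through the
  sum because every summand is increasing.\<close>

lemma nn_integral_eq_sum_measures:
  fixes K :: "'a measure" and N :: "'b \<Rightarrow> 'a measure" and g :: "'a \<Rightarrow> ennreal"
  assumes "\<And>j. j \<in> J \<Longrightarrow> sets (N j) = sets K"
    and emeasure: "\<And>A. A \<in> sets K \<Longrightarrow> emeasure K A = (\<Sum>j\<in>J. emeasure (N j) A)"
    and g: "g \<in> borel_measurable K"
  shows "(\<integral>\<^sup>+ x. g x \<partial>K) = (\<Sum>j\<in>J. \<integral>\<^sup>+ x. g x \<partial>N j)"
proof -
  have measN: "u \<in> borel_measurable (N j)"
    if "u \<in> borel_measurable K" "j \<in> J" for u :: "'a \<Rightarrow> ennreal" and j
    using that assms(1) by (simp cong: measurable_cong_sets)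
  have spN: "space (N j) = space K" if "j \<in> J" for j
    using sets_eq_imp_space_eq[OF assms(1)[OF that]] .
  from g show ?thesis
  proof (induction rule: borel_measurable_induct)
    case (cong f g)
    have "(\<integral>\<^sup>+ x. f x \<partial>N j) = (\<integral>\<^sup>+ x. g x \<partial>N j)" if "j \<in> J" for j
      using cong that by (intro nn_integral_cong) (simp add: spN)
    moreover have "(\<integral>\<^sup>+ x. f x \<partial>K) = (\<integral>\<^sup>+ x. g x \<partial>K)"
      using cong by (intro nn_integral_cong) simp
    ultimately show ?case
      using cong by simp
  next
    case (set A)
    then show ?case
      using assms by simp
  next
    case (mult u c)
    then show ?case
      by (simp add: nn_integral_cmult sum_distrib_left measN)
  next
    case (add u v)
    then show ?case
      by (simp add: nn_integral_add sum.distrib measN)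
  next
    case (seq U)
    have "(\<integral>\<^sup>+ x. (SUP i. U i) x \<partial>K) = (SUP i. \<integral>\<^sup>+ x. U i x \<partial>K)"
      using seq by (simp add: nn_integral_monotone_convergence_SUP image_comp)
    also have "\<dots> = (SUP i. \<Sum>j\<in>J. \<integral>\<^sup>+ x. U i x \<partial>N j)"
      using seq by simp
    also have "\<dots> = (\<Sum>j\<in>J. SUP i. \<integral>\<^sup>+ x. U i x \<partial>N j)"
      using seq by (intro ennreal_SUP_sum) (auto simp: incseq_def le_fun_def intro!: nn_integral_mono)
    also have "\<dots> = (\<Sum>j\<in>J. \<integral>\<^sup>+ x. (SUP i. U i) x \<partial>N j)"
    proof (rule sum.cong)
      fix j assume "j \<in> J"
      with seq have "\<And>i. U i \<in> borel_measurable (N j)"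
        by (intro measN)
      with seq show "(SUP i. \<integral>\<^sup>+ x. U i x \<partial>N j) = (\<integral>\<^sup>+ x. (SUP i. U i) x \<partial>N j)"
        by (simp add: nn_integral_monotone_convergence_SUP image_comp)
    qed simp
    finally show ?case .
  qed
qed

text \<open>Extending \<open>f\<close> by zero outside \<open>A\<close> makes it globally
  measurable, and the indicator of a subset \<open>B\<close> does not see the extension.\<close>

lemma borel_measurable_indicator_mult_ennreal:
  fixes f :: "real ^ 'n \<Rightarrow> real"
  assumes f: "f \<in> borel_measurable (restrict_space borel A)"
    and [measurable]: "A \<in> sets borel" "B \<in> sets borel" and "B \<subseteq> A"
  shows "(\<lambda>s. indicator B s * ennreal (f s)) \<in> borel_measurable borel"
proof -
  have [measurable]: "(\<lambda>s. indicator A s * f s) \<in> borel_measurable borel"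
    using f by (simp add: borel_measurable_restrict_space_iff)
  have "(\<lambda>s. indicator B s * ennreal (f s)) = (\<lambda>s. indicator B s * ennreal (indicator A s * f s))"
    using \<open>B \<subseteq> A\<close> by (auto simp: fun_eq_iff split: split_indicator)
  also have "\<dots> \<in> borel_measurable borel"
    by measurable
  finally show ?thesis .
qed

section \<open>Integration against the face density of \<open>S\<close>\<close>

lemma max_zero_set_borel [measurable]: "(max_zero_set :: (real ^ 'n) set) \<in> sets borel"
  unfolding max_zero_set_def by measurable

lemma face_borel [measurable]: "(face j :: (real ^ 'n) set) \<in> sets borel"
  unfolding face_def by measurable

lemma face_subset_max_zero_set: "face j \<subseteq> max_zero_set"
  by (auto simp: face_def max_zero_set_def)

text \<open>The law of \<open>S\<close> is a sum of measures, one per face, so integrals against it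
  split accordingly.\<close>

lemma nn_integral_face_density:
  fixes S :: "'w \<Rightarrow> ereal ^ 'n"
  assumes [measurable]: "S \<in> borel_measurable M"
    and f: "has_face_density M S f"
    and g [measurable]: "g \<in> borel_measurable borel"
  shows "(\<integral>\<^sup>+ \<omega>. g (S \<omega>) \<partial>M) =
    (\<Sum>j\<in>UNIV. \<integral>\<^sup>+ x. indicator (face j) (insert_zero j x) * ennreal (f (insert_zero j x)) *
                      g (ereal_vec (insert_zero j x)) \<partial>(\<Pi>\<^sub>M i\<in>UNIV - {j}. lborel))"
proof -
  let ?P = "\<lambda>j. \<Pi>\<^sub>M i\<in>UNIV - {j}. (lborel :: real measure)"
  define w where "w j s = indicator (face j) s * ennreal (f s)" for j s
  have [measurable]: "w j \<in> borel_measurable borel" for j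
    using f unfolding w_def has_face_density_def
    by (intro borel_measurable_indicator_mult_ennreal[OF _ _ _ face_subset_max_zero_set]) auto
  \<comment> \<open>The contribution of face \<open>j\<close> as a measure on the extended space:
    weight the free coordinates by the density, then push forward by the parametrization of the
    face.\<close>
  define N where "N j = distr (density (?P j) (\<lambda>x. w j (insert_zero j x))) borel
      (\<lambda>x. ereal_vec (insert_zero j x))" for j
  have N: "(\<integral>\<^sup>+ z. u z \<partial>N j) = (\<integral>\<^sup>+ x. w j (insert_zero j x) * u (ereal_vec (insert_zero j x)) \<partial>?P j)"
    if [measurable]: "u \<in> borel_measurable borel" for u j
    unfolding N_def by (simp add: nn_integral_distr nn_integral_density)
  have "(\<integral>\<^sup>+ \<omega>. g (S \<omega>) \<partial>M) = (\<integral>\<^sup>+ z. g z \<partial>distr M borel S)"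
    by (simp add: nn_integral_distr)
  also have "\<dots> = (\<Sum>j\<in>UNIV. \<integral>\<^sup>+ z. g z \<partial>N j)"
  proof (rule nn_integral_eq_sum_measures)
    fix B :: "(ereal ^ 'n) set"
    assume "B \<in> sets (distr M borel S)"
    then have B [measurable]: "B \<in> sets borel" by simp
    have "emeasure (N j) B = (\<integral>\<^sup>+ x. indicator (face j) (insert_zero j x) *
        indicator B (ereal_vec (insert_zero j x)) * ennreal (f (insert_zero j x)) \<partial>?P j)" for j
    proof -
      have "emeasure (N j) B = (\<integral>\<^sup>+ z. indicator B z \<partial>N j)"
        by (subst nn_integral_indicator) (simp_all add: N_def)
      then show ?thesis
        by (simp add: N w_def ac_simps)
    qed
    then show "emeasure (distr M borel S) B = (\<Sum>j\<in>UNIV. emeasure (N j) B)"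
      using f B by (simp add: emeasure_distr has_face_density_def)
  qed (simp_all add: N_def)
  finally show ?thesis
    by (simp add: N w_def)
qed

text \<open>Every face integral evaluates its integrand at points \<open>ereal_vec s\<close> only,
  so the indicator of the non-finite points integrates to 0.\<close>

lemma AE_finite_of_face_density:
  fixes S :: "'w \<Rightarrow> ereal ^ 'n"
  assumes [measurable]: "S \<in> borel_measurable M" and f: "has_face_density M S f"
  shows "AE \<omega> in M. S \<omega> \<in> range ereal_vec"
proof -
  have "(\<integral>\<^sup>+ \<omega>. indicator (- range ereal_vec) (S \<omega>) \<partial>M) = 0"
    by (subst nn_integral_face_density[OF assms]) simp_all
  then have "AE \<omega> in M. indicator (- range ereal_vec) (S \<omega>) = (0 :: ennreal)"
    by (subst (asm) nn_integral_0_iff_AE) simp_all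
  then show ?thesis
    by (auto elim: AE_mp simp: indicator_eq_0_iff)
qed

section \<open>Matching the sum over the faces with the density of \<open>Z\<close>\<close>

lemma sum_indicator_argmax:
  fixes z :: "real ^ 'n"
  assumes "\<And>i j. i \<noteq> j \<Longrightarrow> z $ i \<noteq> z $ j"
  shows "(\<Sum>j\<in>UNIV. indicator {z. z $ j = vmax z} z) = (1 :: ennreal)"
proof -
  obtain k where k: "z $ k = vmax z" by (rule vmax_attained)
  then have "indicator {z. z $ j = vmax z} z = (if j = k then 1 else 0 :: ennreal)" for j
    using assms[of j k] by (auto simp: indicator_def)
  then show ?thesis by simp
qed

theorem theorem5p5:
  fixes M :: "'w measure"
    and S Z :: "'w \<Rightarrow> ereal ^ 'n"
    and E :: "'w \<Rightarrow> real"
    and f\<^sub>S :: "real ^ 'n \<Rightarrow> real"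
  assumes "prob_space M"
    and "spectral_random_vector M S"
    and "has_face_density M S f\<^sub>S"
    and "distributed M lborel E (exponential_density 1)"
    and "indep_rv M borel S borel E"
    and "\<And>\<omega>. \<omega> \<in> space M \<Longrightarrow> Z \<omega> = S \<omega> + vec (ereal (E \<omega>))"
  shows "has_lebesgue_density M Z
           (\<lambda>z. indicator {z. \<not> z \<le> 0} z * f\<^sub>S (z - vec (vmax z)) * exp (- vmax z))"
proof -
  let ?h = "\<lambda>z. indicator {z. \<not> z \<le> 0} z * f\<^sub>S (z - vec (vmax z)) * exp (- vmax z)"
  let ?p = "exponential_density 1"
  let ?P = "\<lambda>j. \<Pi>\<^sub>M i\<in>UNIV - {j}. (lborel :: real measure)"
  interpret prob_space M by fact
  have S [measurable]: "S \<in> borel_measurable M" and E [measurable]: "E \<in> borel_measurable M"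
    using assms(2,4) by (auto simp: spectral_random_vector_def distributed_def)
  have f_nonneg: "0 \<le> f\<^sub>S (z - vec (vmax z))" for z
    using assms(3) by (simp add: has_face_density_def max_zero_set_def vmax_minus_vec_vmax)
  \<comment> \<open>The extension of \<open>f\<^sub>S\<close> by zero is measurable everywhere and
    agrees with \<open>f\<^sub>S\<close> at \<open>z - vec (vmax z)\<close>, whose maximum is
    0.\<close>
  define w where "w s = indicator max_zero_set s * ennreal (f\<^sub>S s)" for s
  have [measurable]: "w \<in> borel_measurable borel"
    using assms(3) unfolding w_def has_face_density_def
    by (intro borel_measurable_indicator_mult_ennreal[of _ max_zero_set]) auto
  have w: "w (z - vec (vmax z)) = ennreal (f\<^sub>S (z - vec (vmax z)))" for z
    by (simp add: w_def max_zero_set_def vmax_minus_vec_vmax)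
  have h: "ennreal (?h z) = indicator {z. 0 < vmax z} z * (w (z - vec (vmax z)) * ennreal (exp (- vmax z)))" for z
    using f_nonneg[of z] by (simp add: w not_le_zero_iff_vmax_pos ennreal_mult split: split_indicator)
  have h_meas [measurable]: "(\<lambda>z. ennreal (?h z)) \<in> borel_measurable borel"
    unfolding h by measurable
  have Z_eq: "real_vec (Z \<omega>) = (\<lambda>(s, e). real_vec (s + vec (ereal e))) (S \<omega>, E \<omega>)"
    if "\<omega> \<in> space M" for \<omega>
    using that assms(6) by simp
  have Z_meas: "(\<lambda>\<omega>. real_vec (Z \<omega>)) \<in> borel_measurable M"
    by (subst measurable_cong[OF Z_eq]) (assumption, measurable)

  have "distr M lborel (\<lambda>\<omega>. real_vec (Z \<omega>)) = density lborel (\<lambda>z. ennreal (?h z))"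
  proof (rule measure_eqI)
    fix A assume "A \<in> sets (distr M lborel (\<lambda>\<omega>. real_vec (Z \<omega>)))"
    then have A [measurable]: "A \<in> sets borel" by simp
    define g where "g = (\<lambda>(s, e). indicator A (real_vec (s + vec (ereal e) :: ereal ^ 'n)) :: ennreal)"
    have g_meas [measurable]: "g \<in> borel_measurable (borel \<Otimes>\<^sub>M borel)"
      unfolding g_def case_prod_beta
      using borel_measurable_real_vec_add_vec[unfolded case_prod_beta] by measurable
    \<comment> \<open>The integrand of face \<open>j\<close> rewritten in terms of
      \<open>z = s + e\<close>: there \<open>e\<close> is \<open>vmax z\<close>, \<open>s\<close> is
      \<open>z - vec (vmax z)\<close>, and lying on the face means that the maximum of
      \<open>z\<close> is attained at \<open>j\<close>.\<close>
    define G where "G j z = indicator {z. z $ j = vmax z} z * (w (z - vec (vmax z)) *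
        indicator A z * ennreal (?p (vmax z)))" for j z
    have [measurable]: "G j \<in> borel_measurable borel" for j
      unfolding G_def by measurable
    interpret pair_sigma_finite "distr M borel S" "distr M borel E"
      by (intro pair_sigma_finite.intro prob_space_imp_sigma_finite prob_space_distr) auto

    have G_face: "ennreal (?p e) * (indicator (face j) (insert_zero j x) *
        ennreal (f\<^sub>S (insert_zero j x)) * g (ereal_vec (insert_zero j x), e)) =
        G j (insert_zero j x + vec e)" for j x e
    proof (cases "insert_zero j x \<in> face j")
      case True
      then have "vmax (insert_zero j x) = 0" by (simp add: face_def)
      moreover have "insert_zero j x $ j = 0" by (simp add: insert_zero_def)
      ultimately show ?thesis
        using True by (simp add: G_def g_def vmax_add_vec w_def max_zero_set_def
            real_vec_ereal_vec_add mult_ac)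
    next
      \<comment> \<open>Off the face, \<open>insert_zero j x\<close> has component 0 at
        \<open>j\<close> but a nonzero maximum, so after adding \<open>e\<close> the maximum is
        still not attained at \<open>j\<close> and both sides vanish.\<close>
      case False
      moreover have "insert_zero j x $ j = 0" by (simp add: insert_zero_def)
      ultimately show ?thesis
        by (auto simp: face_def G_def vmax_add_vec)
    qed

    have "emeasure (distr M lborel (\<lambda>\<omega>. real_vec (Z \<omega>))) A =
        (\<integral>\<^sup>+ \<omega>. indicator A (real_vec (Z \<omega>)) \<partial>M)"
    proof -
      have "emeasure (distr M lborel (\<lambda>\<omega>. real_vec (Z \<omega>))) A =
          (\<integral>\<^sup>+ z. indicator A z \<partial>distr M lborel (\<lambda>\<omega>. real_vec (Z \<omega>)))"
        by simp
      also have "\<dots> = (\<integral>\<^sup>+ \<omega>. indicator A (real_vec (Z \<omega>)) \<partial>M)"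
        using Z_meas by (intro nn_integral_distr) simp_all
      finally show ?thesis .
    qed
    also have "\<dots> = (\<integral>\<^sup>+ \<omega>. g (S \<omega>, E \<omega>) \<partial>M)"
      by (intro nn_integral_cong) (simp add: g_def assms(6))
    also have "\<dots> = (\<integral>\<^sup>+ y. g y \<partial>(distr M borel S \<Otimes>\<^sub>M distr M borel E))"
      by (subst distr_pair_indep_rv[OF assms(1,5), symmetric]) (simp add: nn_integral_distr)
    \<comment> \<open>Keeping \<open>e\<close> as the outer variable matches the order of
      integration in the shear substitution.\<close>
    also have "\<dots> = (\<integral>\<^sup>+ e. (\<integral>\<^sup>+ s. g (s, e) \<partial>distr M borel S) \<partial>distr M borel E)"
      by (rule nn_integral_snd[symmetric]) simp
    also have "\<dots> = (\<integral>\<^sup>+ e. (\<integral>\<^sup>+ s. g (s, e) \<partial>distr M borel S) \<partial>density lborel (\<lambda>e. ennreal (?p e)))"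
      using assms(4) by (simp add: distributed_def cong: distr_cong)
    \<comment> \<open>For fixed \<open>e\<close> the inner integral is taken back to
      \<open>M\<close>, the form to which the face formula applies.\<close>
    also have "\<dots> = (\<integral>\<^sup>+ e. ennreal (?p e) * (\<integral>\<^sup>+ \<omega>. g (S \<omega>, e) \<partial>M) \<partial>lborel)"
      by (subst nn_integral_density) (simp_all add: nn_integral_distr)
    also have "\<dots> = (\<integral>\<^sup>+ e. (\<Sum>j\<in>UNIV. \<integral>\<^sup>+ x. G j (insert_zero j x + vec e) \<partial>?P j) \<partial>lborel)"
    proof (rule nn_integral_cong)
      fix e :: real
      have [measurable]: "(\<lambda>s. g (s, e)) \<in> borel_measurable borel" by measurable
      have [measurable]: "(\<lambda>s. indicator (face j) s * ennreal (f\<^sub>S s)) \<in> borel_measurable borel" for j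
        using assms(3) unfolding has_face_density_def
        by (intro borel_measurable_indicator_mult_ennreal[OF _ _ _ face_subset_max_zero_set]) auto
      have "(\<integral>\<^sup>+ \<omega>. g (S \<omega>, e) \<partial>M) = (\<Sum>j\<in>UNIV. \<integral>\<^sup>+ x. indicator (face j) (insert_zero j x) *
          ennreal (f\<^sub>S (insert_zero j x)) * g (ereal_vec (insert_zero j x), e) \<partial>?P j)"
        by (rule nn_integral_face_density[OF S assms(3)]) measurable
      moreover have "(\<lambda>x. indicator (face j) (insert_zero j x) * ennreal (f\<^sub>S (insert_zero j x)) *
          g (ereal_vec (insert_zero j x), e)) \<in> borel_measurable (?P j)" for j
        by measurable
      ultimately show "ennreal (?p e) * (\<integral>\<^sup>+ \<omega>. g (S \<omega>, e) \<partial>M) =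
          (\<Sum>j\<in>UNIV. \<integral>\<^sup>+ x. G j (insert_zero j x + vec e) \<partial>?P j)"
        by (simp add: sum_distrib_left nn_integral_cmult[symmetric] G_face)
    qed
    also have "\<dots> = (\<Sum>j\<in>UNIV. \<integral>\<^sup>+ e. (\<integral>\<^sup>+ x. G j (insert_zero j x + vec e) \<partial>?P j) \<partial>lborel)"
    proof (rule nn_integral_sum)
      fix j :: 'n
      \<comment> \<open>Sigma-finiteness makes the inner integral measurable in \<open>e\<close>, as
        needed to exchange the sum with the outer integral.\<close>
      interpret P: sigma_finite_measure "?P j"
        by (rule lborel.sigma_finite) simp
      show "(\<lambda>e. \<integral>\<^sup>+ x. G j (insert_zero j x + vec e) \<partial>?P j) \<in> borel_measurable lborel"
        by measurable
    qed
    \<comment> \<open>The measure-preserving shear is applied on each face separately.\<close>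
    also have "\<dots> = (\<Sum>j\<in>UNIV. \<integral>\<^sup>+ z. G j z \<partial>lborel)"
      by (intro sum.cong nn_integral_lborel_insert_zero[symmetric]) simp_all
    also have "\<dots> = (\<integral>\<^sup>+ z. (\<Sum>j\<in>UNIV. G j z) \<partial>lborel)"
      by (rule nn_integral_sum[symmetric]) simp
    also have "\<dots> = (\<integral>\<^sup>+ z. ennreal (?h z) * indicator A z \<partial>lborel)"
    proof (rule nn_integral_cong_AE)
      show "AE z in lborel. (\<Sum>j\<in>UNIV. G j z) = ennreal (?h z) * indicator A z"
        using AE_lborel_nth_distinct AE_lborel_nth_nonzero
      proof eventually_elim
        case (elim z)
        \<comment> \<open>The maximum is one of the coordinates. Once it is nonzero, the exponential
          density at it agrees with the exponential factor cut off to positive maxima.\<close>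
        have "vmax z \<noteq> 0"
          using elim(2) vmax_attained[of z] by metis
        then have "ennreal (?p (vmax z)) = indicator {z. 0 < vmax z} z * ennreal (exp (- vmax z))"
          by (auto simp: exponential_density_def)
        moreover have "(\<Sum>j\<in>UNIV. G j z) = w (z - vec (vmax z)) * indicator A z * ennreal (?p (vmax z))"
          unfolding G_def sum_distrib_right[symmetric] using elim(1)
          by (subst sum_indicator_argmax) auto
        ultimately show ?case
          unfolding h by (simp add: ac_simps)
      qed
    qed
    also have "\<dots> = emeasure (density lborel (\<lambda>z. ennreal (?h z))) A"
      by (simp add: emeasure_density)
    finally show "emeasure (distr M lborel (\<lambda>\<omega>. real_vec (Z \<omega>))) A =
        emeasure (density lborel (\<lambda>z. ennreal (?h z))) A" .
  qed simp
  then have "distributed M lborel (\<lambda>\<omega>. real_vec (Z \<omega>)) (\<lambda>z. ennreal (?h z))"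
    using Z_meas h_meas by (simp add: distributed_def)
  \<comment> \<open>\<open>E\<close> is real-valued, so \<open>Z\<close> is finite wherever
    \<open>S\<close> is.\<close>
  moreover have "AE \<omega> in M. Z \<omega> \<in> range ereal_vec"
    using AE_finite_of_face_density[OF S assms(3)] AE_space
  proof eventually_elim
    case (elim \<omega>)
    then obtain t where "S \<omega> = ereal_vec t" by auto
    then have "Z \<omega> = ereal_vec (t + vec (E \<omega>))"
      using elim(2) by (simp add: assms(6) ereal_vec_def vec_eq_iff)
    then show ?case by simp
  qed
  ultimately show ?thesis
    using f_nonneg by (simp add: has_lebesgue_density_def)
qed

end
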